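(* Let $n\ge1$ be an integer, $Q=2n+2$ and $T>0$. Let $M:\mathbb R_+\times\mathbb R_+\times\mathbb R_+\to\mathbb R$ be a bounded function with $0<M(\cdot,\cdot,\cdot)\le C_0$ for some constant $C_0$. Assume that $u_0,u_1\in L^1(\mathbb H^n)$ and $\int_{\mathbb H^n}u_1\,dx\ge0$. If $$1<p\le p_c=\frac{Q+1}{Q-1},$$ then there exists no nontrivial weak solution to the problem $$\begin{cases}u_{tt}-M\left(t,\int_{\mathbb H^n}|\nabla_{\mathbb H}u|^2dx,\int_{\mathbb H^n}|\Delta_{\mathbb H}u|^2dx\right)(\Delta_{\mathbb H}u+\Delta_{\mathbb H}u_{tt})=|u|^p,\quad(x,t)\in\Omega=\mathbb H^n\times(0,T),\\ u(x,0)=u_0(x),\quad u_t(x,0)=u_1(x),\quad x\in\mathbb H^n.\end{cases}$$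
   Context: $\mathbb R_+=[0,\infty)$. The Heisenberg group $\mathbb H^n$ is $\mathbb R^{2n+1}$ with points $x=(\xi,\tilde\xi,\tau)$, $\xi,\tilde\xi\in\mathbb R^n$, $\tau\in\mathbb R$, equipped with the vector fields $X_i=\partial_{\xi_i}+2\tilde\xi_i\partial_\tau$, $Y_i=\partial_{\tilde\xi_i}-2\xi_i\partial_\tau$ ($i=1,\dots,n$) and with Lebesgue measure $dx$; its homogeneous dimension is $Q=2n+2$ (dilations $\delta_\lambda(x)=(\lambda\xi,\lambda\tilde\xi,\lambda^2\tau)$). The horizontal gradient is $\nabla_{\mathbb H}=(X_1,\dots,X_n,Y_1,\dots,Y_n)$ and the Kohn-Laplacian is $\Delta_{\mathbb H}=\sum_{i=1}^n(X_i^2+Y_i^2)$; both act in the variable $x$ only. $S^2_2(\mathbb H^n)=\{u: u\in L^2(\mathbb H^n),\ |\nabla_{\mathbb H}u|\in L^2(\mathbb H^n),\ |\Delta_{\mathbb H}u|\in L^2(\mathbb H^n)\}$. Definition. $u$ is a weak solution to the problem on $\Omega=\mathbb H^n\times(0,T)$ with $u_0,u_1\in L^1_{loc}(\mathbb H^n)$ if $u\in C^2(0,T;S^2_2(\mathbb H^n))\cap L^p(\Omega)$ and $$\int_\Omega|u|^p\varphi\,dxdt+\int_{\mathbb H^n}u_1(x)\bigl(\varphi(x,0)-\Delta_{\mathbb H}\varphi(x,0)\bigr)dx-\int_{\mathbb H^n}u_0(x)\bigl(\varphi_t(x,0)-\Delta_{\mathbb H}\varphi_t(x,0)\bigr)dx$$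 $$=\int_\Omega u\varphi_{tt}\,dxdt-\int_\Omega M\left(t,\int_{\mathbb H^n}|\nabla_{\mathbb H}u|^2dx,\int_{\mathbb H^n}|\Delta_{\mathbb H}u|^2dx\right)u\,(\Delta_{\mathbb H}\varphi+\Delta_{\mathbb H}\varphi_{tt})\,dxdt$$ for any test function $0\le\varphi\in C^{2,2}_{x,t}(\Omega)$ (twice continuously differentiable in $x$ and in $t$). *)

theory Defs
  imports "HOL-Analysis.Analysis"
begin

text \<open>Points of the Heisenberg group are triples \<open>(\<xi>, \<eta>, \<tau>)\<close>; its dimension parameter is
  \<open>n = CARD('n)\<close>.\<close>

type_synonym 'n heis = "(real^'n) \<times> (real^'n) \<times> real"

section \<open>Left-invariant vector fields and classical horizontal derivatives\<close>

text \<open>A vector field is given by its coefficient vector at each point, so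
  \<open>X\<^sub>i = \<partial>\<^sub>\<xi>\<^sub>i + 2 \<eta>\<^sub>i \<partial>\<^sub>\<tau>\<close> and
  \<open>Y\<^sub>i = \<partial>\<^sub>\<eta>\<^sub>i - 2 \<xi>\<^sub>i \<partial>\<^sub>\<tau>\<close>.\<close>

definition X_field :: "'n::finite \<Rightarrow> 'n heis \<Rightarrow> 'n heis" where
  "X_field i = (\<lambda>(\<xi>, \<eta>, \<tau>). (axis i 1, 0, 2 * \<eta> $ i))"

definition Y_field :: "'n::finite \<Rightarrow> 'n heis \<Rightarrow> 'n heis" where
  "Y_field i = (\<lambda>(\<xi>, \<eta>, \<tau>). (0, axis i 1, - 2 * \<xi> $ i))"

definition vf_apply :: "('a::real_normed_vector \<Rightarrow> 'a) \<Rightarrow> ('a \<Rightarrow> real) \<Rightarrow> 'a \<Rightarrow> real" where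
  "vf_apply Z f x = frechet_derivative f (at x) (Z x)"

definition hlaplace :: "('n::finite heis \<Rightarrow> real) \<Rightarrow> 'n heis \<Rightarrow> real" where
  "hlaplace f x = (\<Sum>i\<in>UNIV. vf_apply (X_field i) (vf_apply (X_field i) f) x
                            + vf_apply (Y_field i) (vf_apply (Y_field i) f) x)"

section \<open>Weak horizontal derivatives and the space \<open>S\<^sup>2\<^sub>2\<close>\<close>

primrec C_k :: "nat \<Rightarrow> ('a::euclidean_space \<Rightarrow> real) \<Rightarrow> bool" where
  "C_k 0 f \<longleftrightarrow> continuous_on UNIV f"
| "C_k (Suc k) f \<longleftrightarrow> (\<forall>x. f differentiable at x) \<and>
     (\<forall>v. C_k k (\<lambda>x. frechet_derivative f (at x) v))"

definition Cc_infinity :: "('a::euclidean_space \<Rightarrow> real) set" where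
  "Cc_infinity = {\<phi>. (\<forall>k. C_k k \<phi>) \<and> compact (closure {x. \<phi> x \<noteq> 0})}"

definition L1_loc :: "('a::euclidean_space \<Rightarrow> real) \<Rightarrow> bool" where
  "L1_loc f \<longleftrightarrow> (\<forall>K. compact K \<longrightarrow> set_integrable lebesgue K f)"

definition L2_fun :: "('a::euclidean_space \<Rightarrow> real) \<Rightarrow> bool" where
  "L2_fun f \<longleftrightarrow> f \<in> borel_measurable lebesgue \<and> integrable lebesgue (\<lambda>x. (f x)\<^sup>2)"

text \<open>The fields \<open>X\<^sub>i\<close>, \<open>Y\<^sub>i\<close> are divergence free, so their formal adjoints are \<open>-X\<^sub>i\<close>, \<open>-Y\<^sub>i\<close>, and
  the Kohn-Laplacian is formally self-adjoint.\<close>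

definition weak_vf :: "('a::euclidean_space \<Rightarrow> 'a) \<Rightarrow> ('a \<Rightarrow> real) \<Rightarrow> ('a \<Rightarrow> real) \<Rightarrow> bool" where
  "weak_vf Z u g \<longleftrightarrow> L1_loc u \<and> L1_loc g \<and>
     (\<forall>\<phi>\<in>Cc_infinity. (LINT x|lebesgue. u x * vf_apply Z \<phi> x) = - (LINT x|lebesgue. g x * \<phi> x))"

definition weak_hlaplace :: "('n::finite heis \<Rightarrow> real) \<Rightarrow> ('n heis \<Rightarrow> real) \<Rightarrow> bool" where
  "weak_hlaplace u g \<longleftrightarrow> L1_loc u \<and> L1_loc g \<and>
     (\<forall>\<phi>\<in>Cc_infinity. (LINT x|lebesgue. u x * hlaplace \<phi> x) = (LINT x|lebesgue. g x * \<phi> x))"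

text \<open>Weak derivatives are unique up to null sets; the following choose a representative.\<close>

definition wvf :: "('a::euclidean_space \<Rightarrow> 'a) \<Rightarrow> ('a \<Rightarrow> real) \<Rightarrow> 'a \<Rightarrow> real" where
  "wvf Z u = (SOME g. weak_vf Z u g)"

definition whlaplace :: "('n::finite heis \<Rightarrow> real) \<Rightarrow> 'n heis \<Rightarrow> real" where
  "whlaplace u = (SOME g. weak_hlaplace u g)"

definition whgrad_norm :: "('n::finite heis \<Rightarrow> real) \<Rightarrow> 'n heis \<Rightarrow> real" where
  "whgrad_norm u x = sqrt (\<Sum>i\<in>UNIV. (wvf (X_field i) u x)\<^sup>2 + (wvf (Y_field i) u x)\<^sup>2)"

definition S22 :: "('n::finite heis \<Rightarrow> real) set" where
  "S22 = {u. L2_fun u \<and>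
     (\<forall>i. (\<exists>g. weak_vf (X_field i) u g) \<and> (\<exists>g. weak_vf (Y_field i) u g)) \<and>
     L2_fun (whgrad_norm u) \<and>
     (\<exists>g. weak_hlaplace u g) \<and> L2_fun (whlaplace u)}"

definition S22_norm :: "('n::finite heis \<Rightarrow> real) \<Rightarrow> real" where
  "S22_norm u = sqrt ((LINT x|lebesgue. (u x)\<^sup>2) + (LINT x|lebesgue. (whgrad_norm u x)\<^sup>2)
                    + (LINT x|lebesgue. (whlaplace u x)\<^sup>2))"

text \<open>A curve in \<open>S\<^sup>2\<^sub>2\<close> is a time-dependent family \<open>u t\<close> of representatives; the limits are
  taken in the \<open>S\<^sup>2\<^sub>2\<close> norm.\<close>

definition has_S22_derivative ::
    "(real \<Rightarrow> 'n::finite heis \<Rightarrow> real) \<Rightarrow> ('n heis \<Rightarrow> real) \<Rightarrow> real \<Rightarrow> bool" where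
  "has_S22_derivative u v t \<longleftrightarrow>
     ((\<lambda>s. S22_norm (\<lambda>x. (u s x - u t x) / (s - t) - v x)) \<longlongrightarrow> 0) (at t)"

definition C2_S22 :: "real \<Rightarrow> (real \<Rightarrow> 'n::finite heis \<Rightarrow> real) \<Rightarrow> bool" where
  "C2_S22 T u \<longleftrightarrow> (\<exists>v w. \<forall>t\<in>{0<..<T}.
     u t \<in> S22 \<and> v t \<in> S22 \<and> w t \<in> S22 \<and>
     has_S22_derivative u (v t) t \<and> has_S22_derivative v (w t) t \<and>
     ((\<lambda>s. S22_norm (\<lambda>x. w s x - w t x)) \<longlongrightarrow> 0) (at t))"

section \<open>Space-time test functions\<close>

text \<open>\<open>C_x k I \<phi>\<close>: all \<open>x\<close>-derivatives of \<open>\<phi>\<close> of order at most \<open>k\<close> exist at the times in \<open>I\<close> and are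
  jointly continuous in \<open>(x, t)\<close>.\<close>

primrec C_x :: "nat \<Rightarrow> real set \<Rightarrow> (real \<Rightarrow> 'a::euclidean_space \<Rightarrow> real) \<Rightarrow> bool" where
  "C_x 0 I \<phi> \<longleftrightarrow> continuous_on (UNIV \<times> I) (\<lambda>(x, t). \<phi> t x)"
| "C_x (Suc k) I \<phi> \<longleftrightarrow> continuous_on (UNIV \<times> I) (\<lambda>(x, t). \<phi> t x) \<and>
     (\<forall>t\<in>I. \<forall>x. \<phi> t differentiable at x) \<and>
     (\<forall>v. C_x k I (\<lambda>t x. frechet_derivative (\<phi> t) (at x) v))"

text \<open>Time derivative on \<open>[0, T]\<close>, one-sided at the end points; in particular \<open>dt T \<phi> 0\<close> is
  \<open>\<phi>\<^sub>t(\<cdot>, 0)\<close>.\<close>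

definition dt :: "real \<Rightarrow> (real \<Rightarrow> 'a \<Rightarrow> real) \<Rightarrow> real \<Rightarrow> 'a \<Rightarrow> real" where
  "dt T \<phi> t x = vector_derivative (\<lambda>s. \<phi> s x) (at t within {0..T})"

text \<open>The class includes the mixed derivatives up to order two in \<open>x\<close> and two in \<open>t\<close>, since
  the weak formulation involves the Kohn-Laplacian of the second time derivative.\<close>

definition C22 :: "real \<Rightarrow> (real \<Rightarrow> 'a::euclidean_space \<Rightarrow> real) \<Rightarrow> bool" where
  "C22 T \<phi> \<longleftrightarrow>
     (\<forall>t\<in>{0..T}. \<forall>x. (\<lambda>s. \<phi> s x) differentiable (at t within {0..T}) \<and>
                      (\<lambda>s. dt T \<phi> s x) differentiable (at t within {0..T})) \<and>
     C_x 2 {0..T} \<phi> \<and> C_x 2 {0..T} (dt T \<phi>) \<and> C_x 2 {0..T} (dt T (dt T \<phi>))"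

text \<open>Test functions are compactly supported in the space variable, as is needed to pair them
  with locally integrable data. No condition is imposed at \<open>t = T\<close>.\<close>

definition test_function :: "real \<Rightarrow> (real \<Rightarrow> 'a::euclidean_space \<Rightarrow> real) \<Rightarrow> bool" where
  "test_function T \<phi> \<longleftrightarrow> C22 T \<phi> \<and> (\<forall>t\<in>{0..T}. \<forall>x. 0 \<le> \<phi> t x) \<and>
     (\<exists>K. compact K \<and> (\<forall>t\<in>{0..T}. \<forall>x. x \<notin> K \<longrightarrow> \<phi> t x = 0))"

section \<open>Weak solutions\<close>

definition Omega :: "real \<Rightarrow> ('n::finite heis \<times> real) set" where
  "Omega T = UNIV \<times> {0<..<T}"

definition Lp_Omega :: "real \<Rightarrow> real \<Rightarrow> (real \<Rightarrow> 'n::finite heis \<Rightarrow> real) \<Rightarrow> bool" where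
  "Lp_Omega p T u \<longleftrightarrow> set_borel_measurable lebesgue (Omega T) (\<lambda>(x, t). u t x) \<and>
     set_integrable lebesgue (Omega T) (\<lambda>(x, t). \<bar>u t x\<bar> powr p)"

definition M_coeff :: "(real \<Rightarrow> real \<Rightarrow> real \<Rightarrow> real) \<Rightarrow> (real \<Rightarrow> 'n::finite heis \<Rightarrow> real)
    \<Rightarrow> real \<Rightarrow> real" where
  "M_coeff M u t = M t (LINT x|lebesgue. (whgrad_norm (u t) x)\<^sup>2)
                       (LINT x|lebesgue. (whlaplace (u t) x)\<^sup>2)"

text \<open>No measurability of \<open>M\<close> is assumed, so the existence of the integral involving it is part
  of the definition; the remaining integrals always exist for the \<open>u\<close>, \<open>u\<^sub>0\<close>, \<open>u\<^sub>1\<close> and \<open>\<phi>\<close>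
  considered.\<close>

definition weak_solution :: "real \<Rightarrow> (real \<Rightarrow> real \<Rightarrow> real \<Rightarrow> real) \<Rightarrow> real \<Rightarrow>
    ('n::finite heis \<Rightarrow> real) \<Rightarrow> ('n heis \<Rightarrow> real) \<Rightarrow> (real \<Rightarrow> 'n heis \<Rightarrow> real) \<Rightarrow> bool" where
  "weak_solution T M p u0 u1 u \<longleftrightarrow>
     L1_loc u0 \<and> L1_loc u1 \<and> C2_S22 T u \<and> Lp_Omega p T u \<and>
     (\<forall>\<phi>. test_function T \<phi> \<longrightarrow>
        set_integrable lebesgue (Omega T)
          (\<lambda>(x, t). M_coeff M u t * u t x * (hlaplace (\<phi> t) x + hlaplace (dt T (dt T \<phi>) t) x)) \<and>
        (LINT (x, t):Omega T|lebesgue. \<bar>u t x\<bar> powr p * \<phi> t x)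
        + (LINT x|lebesgue. u1 x * (\<phi> 0 x - hlaplace (\<phi> 0) x))
        - (LINT x|lebesgue. u0 x * (dt T \<phi> 0 x - hlaplace (dt T \<phi> 0) x))
        = (LINT (x, t):Omega T|lebesgue. u t x * dt T (dt T \<phi>) t x)
        - (LINT (x, t):Omega T|lebesgue.
             M_coeff M u t * u t x * (hlaplace (\<phi> t) x + hlaplace (dt T (dt T \<phi>) t) x)))"

definition trivial_on_Omega :: "real \<Rightarrow> (real \<Rightarrow> 'n::finite heis \<Rightarrow> real) \<Rightarrow> bool" where
  "trivial_on_Omega T u \<longleftrightarrow> (AE (x, t) in lebesgue. (x, t) \<in> Omega T \<longrightarrow> u t x = 0)"

end

theory Submission
  imports Defs "HOL-Real_Asymp.Real_Asymp"
begin

text \<open>Test functions are unrestricted at \<open>t = T\<close>, so cut-offs \<open>\<psi>\<close> that do not depend on time are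
  admissible. For them the weak formulation reduces to
  \<open>\<integral>\<integral>|u|\<^sup>p \<psi> + \<integral>u\<^sub>1 (\<psi> - \<Delta>\<psi>) = -\<integral>\<integral>M u \<Delta>\<psi>\<close>. If \<open>\<psi>\<close> is supported in a Koranyi ball of radius
  \<open>R\<close>, on which \<open>|\<Delta>\<psi>|\<close> is of order \<open>R powr (-2)\<close>, Young's inequality bounds the right-hand side by
  \<open>(1/p) \<integral>\<integral>|u|\<^sup>p + C R powr (Q - 2q)\<close>, where \<open>q\<close> is the exponent conjugate to \<open>p\<close>. The condition
  \<open>p \<le> (Q + 1) / (Q - 1)\<close> says \<open>2q \<ge> Q + 1\<close>, so the limit \<open>R \<rightarrow> \<infinity>\<close> gives
  \<open>(1 - 1/p) \<integral>\<integral>|u|\<^sup>p \<le> - \<integral>u\<^sub>1 \<le> 0\<close>.\<close>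

section \<open>Calculus for vector fields\<close>

lemma vf_apply_eqI:
  "(f has_derivative f') (at x) \<Longrightarrow> vf_apply Z f x = f' (Z x)"
  by (simp add: vf_apply_def flip: frechet_derivative_at)

lemma vf_apply_compose:
  assumes "(h has_real_derivative h') (at (f x))" and "f differentiable at x"
  shows "vf_apply Z (\<lambda>x. h (f x)) x = h' * vf_apply Z f x"
proof -
  have "(h has_derivative (\<lambda>y. h' * y)) (at (f x))"
    using assms(1) by (simp add: has_field_derivative_def)
  from has_derivative_compose[OF assms(2)[unfolded frechet_derivative_works] this]
  show ?thesis
    by (subst vf_apply_eqI) (simp_all add: vf_apply_def)
qed

lemma vf_apply_mult:
  assumes "f differentiable at x" and "g differentiable at x"
  shows "vf_apply Z (\<lambda>x. f x * g x) x = f x * vf_apply Z g x + vf_apply Z f x * g x"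
proof -
  from has_derivative_mult[OF assms[unfolded frechet_derivative_works]]
  show ?thesis
    by (subst vf_apply_eqI) (simp_all add: vf_apply_def)
qed

lemma differentiable_compose_real:
  assumes "(h has_real_derivative h') (at (f x))" and "f differentiable at x"
  shows "(\<lambda>x. h (f x)) differentiable at x"
  using differentiable_compose[of h f x UNIV] assms
  by (metis differentiableI differentiable_at_withinI has_field_derivative_imp_has_derivative)

lemma vf_apply_twice_compose:
  assumes h: "\<And>s. (h has_real_derivative h' s) (at s)"
    and h': "\<And>s. (h' has_real_derivative h'' s) (at s)"
    and f: "\<And>x. f differentiable at x" and Zf: "vf_apply Z f differentiable at x"
  shows "vf_apply Z (vf_apply Z (\<lambda>x. h (f x))) x =
    h'' (f x) * (vf_apply Z f x)\<^sup>2 + h' (f x) * vf_apply Z (vf_apply Z f) x"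
proof -
  have "vf_apply Z (\<lambda>x. h (f x)) = (\<lambda>x. h' (f x) * vf_apply Z f x)"
    using vf_apply_compose[OF h f] by blast
  then show ?thesis
    using vf_apply_mult[OF differentiable_compose_real[where f = f, OF h' f] Zf]
      vf_apply_compose[OF h' f]
    by (simp add: power2_eq_square)
qed

text \<open>Second-order chain rule: only the squared horizontal gradient and the Kohn-Laplacian of
  the inner function enter. For a cut-off built from the gauge it therefore suffices to compute
  these two quantities for \<open>koranyi4\<close>.\<close>

lemma hlaplace_compose:
  fixes f :: "'n::finite heis \<Rightarrow> real"
  assumes h: "\<And>s. (h has_real_derivative h' s) (at s)"
    and h': "\<And>s. (h' has_real_derivative h'' s) (at s)"
    and f: "\<And>x. f differentiable at x"
    and Xf: "\<And>i. vf_apply (X_field i) f differentiable at x"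
    and Yf: "\<And>i. vf_apply (Y_field i) f differentiable at x"
  shows "hlaplace (\<lambda>x. h (f x)) x =
    h'' (f x) * (\<Sum>i\<in>UNIV. (vf_apply (X_field i) f x)\<^sup>2 + (vf_apply (Y_field i) f x)\<^sup>2)
    + h' (f x) * hlaplace f x"
  unfolding hlaplace_def
  by (simp add: vf_apply_twice_compose[OF h h' f Xf] vf_apply_twice_compose[OF h h' f Yf]
      sum.distrib sum_distrib_left algebra_simps)

lemma hlaplace_zero [simp]: "hlaplace (\<lambda>x. 0) (x :: 'n::finite heis) = 0"
proof -
  have "vf_apply Z (\<lambda>x. 0) = (\<lambda>x. 0)" for Z :: "'n heis \<Rightarrow> 'n heis"
    by (rule ext) (simp add: vf_apply_def)
  then show ?thesis by (simp add: hlaplace_def)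
qed

lemma C_k_2_compose:
  fixes f :: "'a::euclidean_space \<Rightarrow> real"
  assumes h: "\<And>s. (h has_real_derivative h' s) (at s)"
    and h': "\<And>s. (h' has_real_derivative h'' s) (at s)"
    and h'': "continuous_on UNIV h''" and "C_k 2 f"
  shows "C_k 2 (\<lambda>x. h (f x))"
proof -
  \<comment> \<open>A directional derivative along \<open>v\<close> is the action of the constant
    field with value \<open>v\<close>, so the product and chain rules for \<open>vf_apply\<close>
    apply to it.\<close>
  let ?D = "\<lambda>v f x. vf_apply (\<lambda>_. v) f x"
  from \<open>C_k 2 f\<close> have f: "f differentiable at x" and Df: "?D v f differentiable at x"
    and D2f: "continuous_on UNIV (?D w (?D v f))" for x v w
    by (simp_all add: numeral_2_eq_2 vf_apply_def[abs_def])
  have 1: "?D v (\<lambda>x. h (f x)) = (\<lambda>x. h' (f x) * ?D v f x)" for v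
    using vf_apply_compose[OF h f] by blast
  have 2: "?D w (\<lambda>x. h' (f x) * ?D v f x) =
      (\<lambda>x. h' (f x) * ?D w (?D v f) x + h'' (f x) * ?D w f x * ?D v f x)" for v w
    using vf_apply_mult[OF differentiable_compose_real[where f = f, OF h' f] Df]
      vf_apply_compose[OF h' f] by force
  have cont: "continuous_on UNIV f" "continuous_on UNIV (?D v f)" for v
    by (auto intro!: differentiable_imp_continuous_on differentiable_at_imp_differentiable_on f Df)
  have "isCont h' s" for s
    using h' by (rule DERIV_isCont)
  then have h'_cont: "continuous_on UNIV h'"
    by (simp add: continuous_at_imp_continuous_on)
  have hf_cont: "continuous_on UNIV (\<lambda>x. h' (f x))" "continuous_on UNIV (\<lambda>x. h'' (f x))"
    using continuous_on_compose2[OF h'_cont cont(1)] continuous_on_compose2[OF h'' cont(1)] by auto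
  have "continuous_on UNIV (?D w (?D v (\<lambda>x. h (f x))))" for v w
    unfolding 1 2
    by (intro continuous_on_add continuous_on_mult hf_cont cont D2f)
  moreover have "?D v (\<lambda>x. h (f x)) differentiable at x" for v x
    unfolding 1 by (intro differentiable_mult differentiable_compose_real[where f = f, OF h' f] Df)
  ultimately show ?thesis
    using differentiable_compose_real[where f = f, OF h f]
    unfolding numeral_2_eq_2 C_k.simps vf_apply_def by blast
qed

section \<open>Test functions constant in time\<close>

lemma C_k_imp_continuous_on: "C_k k f \<Longrightarrow> continuous_on UNIV f"
proof (cases k)
  case (Suc m)
  assume "C_k k f"
  then have "f differentiable_on UNIV"
    by (simp add: Suc differentiable_on_def)
  then show ?thesis by (rule differentiable_imp_continuous_on)
qed simp

text \<open>Agreement with \<open>f\<close> is asked only at times in \<open>I\<close>, because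
  \<open>dt T\<close> of a time-independent function is controlled on [0, T] but unspecified at
  other times.\<close>

lemma C_x_const_in_time:
  assumes "C_k k f" and "\<And>t. t \<in> I \<Longrightarrow> \<phi> t = f"
  shows "C_x k I \<phi>"
proof -
  have cont: "continuous_on (UNIV \<times> I) (\<lambda>(x, t). \<phi> t x)"
    if "C_k k f" "\<And>t. t \<in> I \<Longrightarrow> \<phi> t = f" for k f \<phi>
  proof -
    have "continuous_on (UNIV \<times> I) (\<lambda>z. f (fst z))"
      by (rule continuous_on_compose2[OF C_k_imp_continuous_on[OF that(1)]])
         (auto intro: continuous_on_fst continuous_on_id)
    then show ?thesis
      by (rule continuous_on_eq) (auto simp: that(2))
  qed
  show ?thesis
    using assms
  proof (induction k arbitrary: f \<phi>)
    case 0
    show ?case using cont[OF 0] by simp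
  next
    case (Suc k f \<phi>)
    have "C_x k I (\<lambda>t x. frechet_derivative (\<phi> t) (at x) v)" for v
      using Suc.prems by (intro Suc.IH[of "\<lambda>x. frechet_derivative f (at x) v"]) auto
    then show ?case using cont[OF Suc.prems] Suc.prems by simp
  qed
qed

lemma has_vector_derivative_const_in_time:
  assumes "t \<in> {0..T}" and "\<And>s. s \<in> {0..T} \<Longrightarrow> \<phi> s x = c"
  shows "((\<lambda>s. \<phi> s x) has_vector_derivative 0) (at t within {0..T})"
  by (rule has_vector_derivative_transform[OF assms(1) _ has_vector_derivative_const[of c]])
     (use assms in simp)

text \<open>Constancy on [0, T] alone is assumed, which allows a second application to
  \<open>dt T \<phi>\<close>. Since \<open>T > 0\<close>, the derivative within the interval is
  unique, also at the end points.\<close>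

lemma dt_const_in_time:
  assumes "T > 0" "t \<in> {0..T}" "\<And>s x. s \<in> {0..T} \<Longrightarrow> \<phi> s x = f x"
  shows "dt T \<phi> t = (\<lambda>x. 0)"
proof
  show "dt T \<phi> t x = 0" for x
    unfolding dt_def
    by (rule vector_derivative_within_closed_interval[OF assms(1,2)
          has_vector_derivative_const_in_time[OF assms(2), of \<phi> x "f x"]])
       (rule assms(3))
qed

lemma C_k_zero: "C_k k (\<lambda>x. 0)"
  by (induction k) simp_all

lemma test_function_const_in_time:
  assumes T: "T > 0" and f: "C_k 2 f" "\<And>x. 0 \<le> f x"
    and K: "compact K" "\<And>x. x \<notin> K \<Longrightarrow> f x = 0"
  shows "test_function T (\<lambda>t. f)"
proof -
  have 1: "dt T (\<lambda>t. f) t = (\<lambda>x. 0)" if "t \<in> {0..T}" for t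
    by (rule dt_const_in_time[OF T that, of _ f]) simp
  have 2: "dt T (dt T (\<lambda>t. f)) t = (\<lambda>x. 0)" if "t \<in> {0..T}" for t
    by (rule dt_const_in_time[OF T that]) (simp add: 1)
  have "(\<lambda>s. dt T (\<lambda>t. f) s x) differentiable (at t within {0..T})" if "t \<in> {0..T}" for t x
    using has_vector_derivative_const_in_time[OF that, of "dt T (\<lambda>t. f)" x 0] 1
    by (auto simp: has_vector_derivative_def intro: differentiableI)
  moreover have "C_x 2 {0..T} (\<lambda>t. f)" "C_x 2 {0..T} (dt T (\<lambda>t. f))"
    "C_x 2 {0..T} (dt T (dt T (\<lambda>t. f)))"
    by (rule C_x_const_in_time[OF f(1)] C_x_const_in_time[OF C_k_zero], simp add: 1 2)+
  ultimately have "C22 T (\<lambda>t. f)"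
    by (simp add: C22_def)
  then show ?thesis
    using f K by (auto simp: test_function_def)
qed

section \<open>The cut-off functions\<close>

text \<open>Away from 0 the function coincides locally with a power or with 0; at 0 its difference
  quotient is dominated by \<open>(max 0 y) ^ Suc k\<close>, which tends to 0. The exponents are
  those from two upwards, for which the corner of the positive part is smoothed out.\<close>

lemma has_real_derivative_pos_part_power:
  "((\<lambda>s::real. (max 0 s) ^ Suc (Suc k)) has_real_derivative real (Suc (Suc k)) * (max 0 s) ^ Suc k) (at s)"
proof -
  consider "s > 0" | "s < 0" | "s = 0" by linarith
  then show ?thesis
  proof cases
    case 1
    have "((\<lambda>s::real. s ^ Suc (Suc k)) has_real_derivative real (Suc (Suc k)) * (max 0 s) ^ Suc k) (at s)"
      using DERIV_pow[of "Suc (Suc k)" s] 1 by simp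
    then show ?thesis
      by (rule has_field_derivative_transform_within_open[of _ _ _ "{0<..}"]) (use 1 in auto)
  next
    case 2
    have "((\<lambda>s::real. 0) has_real_derivative real (Suc (Suc k)) * (max 0 s) ^ Suc k) (at s)"
      using 2 by simp
    then show ?thesis
      by (rule has_field_derivative_transform_within_open[of _ _ _ "{..<0}"]) (use 2 in auto)
  next
    case 3
    have "((\<lambda>y::real. (max 0 y) ^ Suc (Suc k) / y) \<longlongrightarrow> 0) (at 0)"
    proof (rule Lim_null_comparison)
      show "\<forall>\<^sub>F y in at 0. norm ((max 0 y) ^ Suc (Suc k) / y) \<le> (max 0 y) ^ Suc k"
        by (auto intro!: always_eventually simp: max_def)
      have "((\<lambda>y::real. (max 0 y) ^ Suc k) \<longlongrightarrow> (max 0 0) ^ Suc k) (at 0)"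
        by (intro tendsto_intros)
      then show "((\<lambda>y::real. (max 0 y) ^ Suc k) \<longlongrightarrow> 0) (at 0)" by simp
    qed
    then show ?thesis
      unfolding 3 by (simp add: DERIV_def)
  qed
qed

text \<open>The fourth power of the Koranyi gauge. It is homogeneous of degree four with respect to the
  dilations of the Heisenberg group.\<close>

definition koranyi4 :: "'n::finite heis \<Rightarrow> real" where
  "koranyi4 x = (fst x \<bullet> fst x + fst (snd x) \<bullet> fst (snd x))\<^sup>2 + (snd (snd x))\<^sup>2"

definition koranyi4_deriv :: "'n::finite heis \<Rightarrow> 'n heis \<Rightarrow> real" where
  "koranyi4_deriv x v =
    4 * (fst x \<bullet> fst x + fst (snd x) \<bullet> fst (snd x)) * (fst x \<bullet> fst v + fst (snd x) \<bullet> fst (snd v))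
    + 2 * snd (snd x) * snd (snd v)"

lemma koranyi4_nonneg: "0 \<le> koranyi4 x"
  by (simp add: koranyi4_def)

lemma has_derivative_koranyi4: "(koranyi4 has_derivative koranyi4_deriv x) (at x)"
  unfolding koranyi4_def koranyi4_deriv_def
  by (auto intro!: derivative_eq_intros simp: fun_eq_iff inner_commute algebra_simps)

lemma differentiable_koranyi4: "koranyi4 differentiable at x"
  using has_derivative_koranyi4 by (rule differentiableI)

lemma differentiable_koranyi4_deriv: "(\<lambda>x. koranyi4_deriv x v) differentiable at x"
  unfolding koranyi4_deriv_def
  by (rule differentiableI) (rule derivative_eq_intros refl)+

lemma continuous_koranyi4_deriv2:
  "continuous_on UNIV (\<lambda>x. frechet_derivative (\<lambda>x. koranyi4_deriv x v) (at x) w)"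
proof -
  have "frechet_derivative (\<lambda>x. koranyi4_deriv x v) (at x) = (\<lambda>w.
     8 * (fst x \<bullet> fst w + fst (snd x) \<bullet> fst (snd w)) * (fst x \<bullet> fst v + fst (snd x) \<bullet> fst (snd v))
    + 4 * (fst x \<bullet> fst x + fst (snd x) \<bullet> fst (snd x)) * (fst w \<bullet> fst v + fst (snd w) \<bullet> fst (snd v))
    + 2 * snd (snd w) * snd (snd v))" for x
    unfolding koranyi4_deriv_def
    by (rule frechet_derivative_at[symmetric])
       (auto intro!: derivative_eq_intros simp: fun_eq_iff inner_commute algebra_simps)
  then show ?thesis
    by (simp only:) (intro continuous_intros)
qed

lemma C_k_2_koranyi4: "C_k 2 koranyi4"
  unfolding numeral_2_eq_2 C_k.simps frechet_derivative_at[OF has_derivative_koranyi4, symmetric]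
  using differentiable_koranyi4 differentiable_koranyi4_deriv continuous_koranyi4_deriv2 by blast

section \<open>Horizontal derivatives of the Koranyi gauge\<close>

lemma vf_apply_X_koranyi4:
  "vf_apply (X_field i) koranyi4 = (\<lambda>x.
     4 * (fst x \<bullet> fst x + fst (snd x) \<bullet> fst (snd x)) * fst x $ i + 4 * fst (snd x) $ i * snd (snd x))"
  by (rule ext, subst vf_apply_eqI[OF has_derivative_koranyi4])
     (simp add: koranyi4_deriv_def X_field_def inner_axis case_prod_beta)

lemma vf_apply_Y_koranyi4:
  "vf_apply (Y_field i) koranyi4 = (\<lambda>x.
     4 * (fst x \<bullet> fst x + fst (snd x) \<bullet> fst (snd x)) * fst (snd x) $ i - 4 * fst x $ i * snd (snd x))"
  by (rule ext, subst vf_apply_eqI[OF has_derivative_koranyi4])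
     (simp add: koranyi4_deriv_def Y_field_def inner_axis case_prod_beta)

lemma differentiable_vf_apply_koranyi4:
  "vf_apply (X_field i) koranyi4 differentiable at x"
  "vf_apply (Y_field i) koranyi4 differentiable at x"
  unfolding vf_apply_X_koranyi4 vf_apply_Y_koranyi4
  by (rule differentiableI, (rule derivative_eq_intros refl bounded_linear.has_derivative[OF bounded_linear_vec_nth])+)+

lemma vf_apply_XX_koranyi4:
  "vf_apply (X_field i) (vf_apply (X_field i) koranyi4) x =
     4 * (fst x \<bullet> fst x + fst (snd x) \<bullet> fst (snd x)) + 8 * ((fst x $ i)\<^sup>2 + (fst (snd x) $ i)\<^sup>2)"
  unfolding vf_apply_X_koranyi4
  by (subst vf_apply_eqI,
      (rule derivative_eq_intros refl bounded_linear.has_derivative[OF bounded_linear_vec_nth])+)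
     (simp add: X_field_def inner_axis inner_axis' case_prod_beta power2_eq_square algebra_simps)

lemma vf_apply_YY_koranyi4:
  "vf_apply (Y_field i) (vf_apply (Y_field i) koranyi4) x =
     4 * (fst x \<bullet> fst x + fst (snd x) \<bullet> fst (snd x)) + 8 * ((fst x $ i)\<^sup>2 + (fst (snd x) $ i)\<^sup>2)"
  unfolding vf_apply_Y_koranyi4
  by (subst vf_apply_eqI,
      (rule derivative_eq_intros refl bounded_linear.has_derivative[OF bounded_linear_vec_nth])+)
     (simp add: Y_field_def inner_axis inner_axis' case_prod_beta power2_eq_square algebra_simps)

lemma inner_self_vec: "(a::real^'n::finite) \<bullet> a = (\<Sum>i\<in>UNIV. (a $ i)\<^sup>2)"
  by (simp add: inner_vec_def power2_eq_square)

text \<open>Write z for the squared length of the horizontal part of \<open>x\<close>. Each pair of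
  second derivatives contributes 8 z plus 16 times the squares of the i-th coordinates, and these
  squares add up to z over all i.\<close>

lemma hlaplace_koranyi4:
  fixes x :: "'n::finite heis"
  shows "hlaplace koranyi4 x =
    (8 * real CARD('n) + 16) * (fst x \<bullet> fst x + fst (snd x) \<bullet> fst (snd x))"
  unfolding hlaplace_def vf_apply_XX_koranyi4 vf_apply_YY_koranyi4
  by (simp add: sum.distrib inner_self_vec flip: sum_distrib_left) (simp add: algebra_simps)

text \<open>The mixed terms in the squares of the X and Y derivatives have opposite signs and cancel
  for each index. What remains factors through \<open>koranyi4 x\<close>.\<close>

lemma hgrad_koranyi4:
  fixes x :: "'n::finite heis"
  shows "(\<Sum>i\<in>UNIV. (vf_apply (X_field i) koranyi4 x)\<^sup>2 + (vf_apply (Y_field i) koranyi4 x)\<^sup>2)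
    = 16 * (fst x \<bullet> fst x + fst (snd x) \<bullet> fst (snd x)) * koranyi4 x"
proof -
  let ?z = "fst x \<bullet> fst x + fst (snd x) \<bullet> fst (snd x)"
  have "(vf_apply (X_field i) koranyi4 x)\<^sup>2 + (vf_apply (Y_field i) koranyi4 x)\<^sup>2
      = (16 * koranyi4 x) * ((fst x $ i)\<^sup>2 + (fst (snd x) $ i)\<^sup>2)" for i
    unfolding vf_apply_X_koranyi4 vf_apply_Y_koranyi4 koranyi4_def by algebra
  then show ?thesis
    by (simp add: sum.distrib inner_self_vec flip: sum_distrib_left)
qed

text \<open>The exponent three is the least one for which the cut-off is twice continuously
  differentiable across the boundary of its support.\<close>

definition cutoff :: "real \<Rightarrow> 'n::finite heis \<Rightarrow> real" where
  "cutoff R x = (max 0 (1 - koranyi4 x / R ^ 4)) ^ 3"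

text \<open>Used with \<open>a = R ^ 4\<close>. The formulas hold for every \<open>a\<close>: at
  \<open>a = 0\<close> division by zero makes the profile constant and both derivatives zero, so the
  regularity of \<open>cutoff R\<close> needs no condition on \<open>R\<close>.\<close>

lemma cutoff_profile_deriv:
  fixes a :: real
  shows "((\<lambda>s. (max 0 (1 - s / a)) ^ 3) has_real_derivative - (3 / a) * (max 0 (1 - s / a))\<^sup>2) (at s)"
    and "((\<lambda>s. - (3 / a) * (max 0 (1 - s / a))\<^sup>2) has_real_derivative
           (6 / a\<^sup>2) * max 0 (1 - s / a)) (at s)"
proof -
  have l: "((\<lambda>s. 1 - s / a) has_real_derivative - 1 / a) (at s)"
    using DERIV_diff[OF DERIV_const DERIV_cdivide[OF DERIV_ident]] by simp
  from DERIV_chain2[OF has_real_derivative_pos_part_power[of 1] l]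
  show "((\<lambda>s. (max 0 (1 - s / a)) ^ 3) has_real_derivative - (3 / a) * (max 0 (1 - s / a))\<^sup>2) (at s)"
    by (simp add: numeral_3_eq_3 numeral_2_eq_2)
  from DERIV_cmult[OF DERIV_chain2[OF has_real_derivative_pos_part_power[of 0] l], of "- (3 / a)"]
  show "((\<lambda>s. - (3 / a) * (max 0 (1 - s / a))\<^sup>2) has_real_derivative
           (6 / a\<^sup>2) * max 0 (1 - s / a)) (at s)"
    by (simp add: numeral_2_eq_2 algebra_simps)
qed

lemma C_k_2_cutoff: "C_k 2 (cutoff R)"
  unfolding cutoff_def[abs_def]
  by (rule C_k_2_compose[OF cutoff_profile_deriv _ C_k_2_koranyi4])
     (unfold divide_inverse, intro continuous_intros)

lemma cutoff_bounds: "0 \<le> cutoff R x" "cutoff R x \<le> 1"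
  using koranyi4_nonneg[of x] by (auto simp: cutoff_def intro!: power_le_one)

lemma hlaplace_cutoff:
  fixes x :: "'n::finite heis"
  shows "hlaplace (cutoff R) x =
    (6 / (R ^ 4)\<^sup>2) * max 0 (1 - koranyi4 x / R ^ 4) *
       (16 * (fst x \<bullet> fst x + fst (snd x) \<bullet> fst (snd x)) * koranyi4 x)
    - (3 / R ^ 4) * (max 0 (1 - koranyi4 x / R ^ 4))\<^sup>2 *
       ((8 * real CARD('n) + 16) * (fst x \<bullet> fst x + fst (snd x) \<bullet> fst (snd x)))"
  unfolding cutoff_def[abs_def]
  by (subst hlaplace_compose[OF cutoff_profile_deriv differentiable_koranyi4
        differentiable_vf_apply_koranyi4])
     (simp add: hgrad_koranyi4 hlaplace_koranyi4)

section \<open>Continuity, size and support of the cut-offs\<close>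

lemma continuous_on_koranyi4 [continuous_intros]:
  "continuous_on A f \<Longrightarrow> continuous_on A (\<lambda>x. koranyi4 (f x))"
  unfolding koranyi4_def by (intro continuous_intros)

lemma continuous_on_cutoff: "continuous_on A (cutoff R)"
  \<comment> \<open>Multiplication by a constant inverse is continuous without the side condition
    that \<open>R ^ 4\<close> be nonzero.\<close>
  unfolding cutoff_def[abs_def] divide_inverse by (intro continuous_intros)

lemma continuous_on_hlaplace_cutoff: "continuous_on A (hlaplace (cutoff R))"
  unfolding hlaplace_cutoff[abs_def] divide_inverse by (intro continuous_intros)

text \<open>Where the cut-off is positive, \<open>koranyi4 x\<close> is below \<open>R ^ 4\<close>
  and the squared horizontal length is at most \<open>R\<^sup>2\<close>. The gradient term then
  gives 96 and the Laplacian term 24 n + 48, both over \<open>R\<^sup>2\<close>.\<close>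

lemma hlaplace_cutoff_bound:
  fixes x :: "'n::finite heis"
  assumes "R > 0"
  shows "\<bar>hlaplace (cutoff R) x\<bar> \<le> (24 * real CARD('n) + 144) / R\<^sup>2"
proof (cases "koranyi4 x < R ^ 4")
  case False
  then have "max 0 (1 - koranyi4 x / R ^ 4) = 0" using assms by (simp add: field_simps)
  then show ?thesis unfolding hlaplace_cutoff by simp
next
  case True
  define z where "z = fst x \<bullet> fst x + fst (snd x) \<bullet> fst (snd x)"
  define m where "m = max 0 (1 - koranyi4 x / R ^ 4)"
  have z0: "z \<ge> 0" by (simp add: z_def)
  have m: "0 \<le> m" "m \<le> 1" using koranyi4_nonneg[of x] by (auto simp: m_def)
  have m2: "m\<^sup>2 \<le> 1" using m by (simp add: power_le_one)
  have "z\<^sup>2 \<le> (R\<^sup>2)\<^sup>2" using True by (simp add: koranyi4_def z_def) (smt (verit) zero_le_power2)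
  then have z: "z \<le> R\<^sup>2" by (rule power2_le_imp_le) simp
  have A: "(6 / (R ^ 4)\<^sup>2) * m * (16 * z * koranyi4 x) \<le> (6 / (R ^ 4)\<^sup>2) * 1 * (16 * R\<^sup>2 * R ^ 4)"
    using m z z0 True koranyi4_nonneg[of x] by (intro mult_mono) auto
  have B: "(3 / R ^ 4) * m\<^sup>2 * ((8 * real CARD('n) + 16) * z)
      \<le> (3 / R ^ 4) * 1 * ((8 * real CARD('n) + 16) * R\<^sup>2)"
    using m2 z z0 by (intro mult_mono) auto
  have A0: "0 \<le> (6 / (R ^ 4)\<^sup>2) * m * (16 * z * koranyi4 x)"
    using m z0 koranyi4_nonneg[of x] by simp
  have B0: "0 \<le> (3 / R ^ 4) * m\<^sup>2 * ((8 * real CARD('n) + 16) * z)"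
    using z0 by simp
  have "\<bar>hlaplace (cutoff R) x\<bar> \<le> (6 / (R ^ 4)\<^sup>2) * 1 * (16 * R\<^sup>2 * R ^ 4)
      + (3 / R ^ 4) * 1 * ((8 * real CARD('n) + 16) * R\<^sup>2)"
    unfolding hlaplace_cutoff z_def[symmetric] m_def[symmetric]
    using A B A0 B0 by linarith
  also have "\<dots> = (24 * real CARD('n) + 144) / R\<^sup>2"
    using assms by (simp add: field_simps power2_eq_square eval_nat_numeral)
  finally show ?thesis .
qed

text \<open>A box replaces the Koranyi ball because its measure is explicit. The vertical half-side
  \<open>R\<^sup>2\<close> follows the group dilations, so the volume keeps the order of R to the
  power Q.\<close>

definition cutoff_box :: "real \<Rightarrow> 'n::finite heis set" where
  "cutoff_box R = cbox (\<chi> i. - R, \<chi> i. - R, - (R\<^sup>2)) (\<chi> i. R, \<chi> i. R, R\<^sup>2)"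

text \<open>By contradiction: below the level \<open>R ^ 4\<close> each of the two squares in the
  gauge is at most the square of \<open>R\<^sup>2\<close>, which bounds every coordinate.\<close>

lemma koranyi4_ge_outside_box:
  assumes "R > 0" "x \<notin> cutoff_box R"
  shows "koranyi4 x \<ge> R ^ 4"
proof (rule ccontr)
  assume "\<not> ?thesis"
  then have lt: "koranyi4 x < (R\<^sup>2)\<^sup>2" by simp
  define z where "z = fst x \<bullet> fst x + fst (snd x) \<bullet> fst (snd x)"
  have k: "koranyi4 x = z\<^sup>2 + (snd (snd x))\<^sup>2" by (simp add: koranyi4_def z_def)
  have "z\<^sup>2 \<le> (R\<^sup>2)\<^sup>2" using lt k by (smt (verit) zero_le_power2)
  then have z: "z \<le> R\<^sup>2" by (rule power2_le_imp_le) simp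
  have "(snd (snd x))\<^sup>2 \<le> (R\<^sup>2)\<^sup>2" using lt k by (smt (verit) zero_le_power2)
  then have t: "\<bar>snd (snd x)\<bar> \<le> R\<^sup>2" using abs_le_square_iff[of "snd (snd x)" "R\<^sup>2"] by simp
  have "(fst x $ i)\<^sup>2 \<le> fst x \<bullet> fst x" "(fst (snd x) $ i)\<^sup>2 \<le> fst (snd x) \<bullet> fst (snd x)" for i
    by (auto simp: inner_self_vec intro!: member_le_sum)
  then have "(fst x $ i)\<^sup>2 \<le> R\<^sup>2" "(fst (snd x) $ i)\<^sup>2 \<le> R\<^sup>2" for i
    using z unfolding z_def by (smt (verit) inner_ge_zero)+
  then have "\<bar>fst x $ i\<bar> \<le> R" "\<bar>fst (snd x) $ i\<bar> \<le> R" for i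
    using assms(1) by (auto simp: abs_le_square_iff[symmetric])
  then have "x \<in> cutoff_box R"
    using t unfolding cutoff_box_def
    by (cases x) (auto simp: cbox_Pair_eq mem_box_cart abs_le_iff minus_le_iff)
  with assms(2) show False by simp
qed

lemma cutoff_outside_box:
  assumes "R > 0" "x \<notin> cutoff_box R"
  shows "cutoff R x = 0" "hlaplace (cutoff R) x = 0"
proof -
  have "max 0 (1 - koranyi4 x / R ^ 4) = 0"
    using koranyi4_ge_outside_box[OF assms] assms(1) by (simp add: field_simps)
  then show "cutoff R x = 0" "hlaplace (cutoff R) x = 0"
    by (simp_all add: cutoff_def hlaplace_cutoff)
qed

text \<open>The box has 2 n sides of length 2 R and one of length 2 R^2; the resulting exponent of R
  is the homogeneous dimension Q.\<close>

lemma content_cutoff_box: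
  assumes "R > 0"
  shows "measure lborel (cutoff_box R :: 'n::finite heis set)
    = 2 ^ (2 * CARD('n) + 1) * R ^ (2 * CARD('n) + 2)"
proof -
  have "cbox (\<chi> i::'n. - R) (\<chi> i. R) \<noteq> {}" using assms by (simp add: interval_ne_empty_cart)
  moreover have "(2::real) ^ CARD('n) * 2 ^ CARD('n) = 4 ^ CARD('n)"
    by (simp flip: power_mult_distrib)
  ultimately show ?thesis using assms
    unfolding cutoff_box_def content_Pair
    by (subst (1 2) content_cbox_cart)
       (simp_all add: power_mult_distrib power_add power_mult power2_eq_square)
qed

lemma test_function_cutoff:
  assumes "T > 0" and "R > 0"
  shows "test_function T (\<lambda>t. cutoff R)"
proof (rule test_function_const_in_time[OF assms(1) C_k_2_cutoff cutoff_bounds(1)])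
  show "compact (cutoff_box R)" by (simp add: cutoff_box_def)
qed (rule cutoff_outside_box(1)[OF assms(2)])

section \<open>Pointwise limits along the radii 1, 2, 3, ..\<close>

lemma LIMSEQ_cutoff: "(\<lambda>k. cutoff (real (Suc k)) x) \<longlonglongrightarrow> 1"
proof -
  have "(\<lambda>k. max 0 (1 - koranyi4 x / real (Suc k) ^ 4) ^ 3) \<longlonglongrightarrow> max 0 (1 - 0) ^ 3"
    by (intro tendsto_intros) real_asymp
  then show ?thesis by (simp add: cutoff_def)
qed

lemma LIMSEQ_hlaplace_cutoff: "(\<lambda>k. hlaplace (cutoff (real (Suc k))) x) \<longlonglongrightarrow> 0"
proof (rule Lim_null_comparison)
  show "\<forall>\<^sub>F k in sequentially. norm (hlaplace (cutoff (real (Suc k))) x)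
      \<le> (24 * real CARD('a) + 144) / (real (Suc k))\<^sup>2"
    using hlaplace_cutoff_bound[of "real (Suc _)" x] by (auto intro!: always_eventually)
  show "(\<lambda>k. (24 * real CARD('a) + 144) / (real (Suc k))\<^sup>2) \<longlonglongrightarrow> 0"
    by real_asymp
qed

lemma borel_measurable_lebesgue_continuous:
  fixes f :: "'a::euclidean_space \<Rightarrow> real"
  assumes "continuous_on UNIV f"
  shows "f \<in> borel_measurable lebesgue"
  using borel_measurable_continuous_onI[OF assms] by (simp add: measurable_completion)

section \<open>The estimate for weak solutions\<close>

text \<open>The weak equation tested with a single cut-off. The last term is the constant part of
  Young's inequality integrated over the support box times [0, T]; the term with \<open>u1\<close>
  is left untouched until the limit.\<close>

lemma weak_solution_cutoff_estimate:
  fixes u :: "real \<Rightarrow> 'n::finite heis \<Rightarrow> real"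
  assumes sol: "weak_solution T M p u0 u1 u"
    and T: "T > 0" and R: "R > 0" and p: "1 < p" and q: "1 < q" "1 / p + 1 / q = 1"
    and M: "\<And>t a b. t \<ge> 0 \<Longrightarrow> a \<ge> 0 \<Longrightarrow> b \<ge> 0 \<Longrightarrow> \<bar>M t a b\<bar> \<le> C0"
  shows "(LINT (x, t):Omega T|lebesgue. \<bar>u t x\<bar> powr p * cutoff R x)
      + (LINT x|lebesgue. u1 x * (cutoff R x - hlaplace (cutoff R) x))
    \<le> (LINT (x, t):Omega T|lebesgue. \<bar>u t x\<bar> powr p) / p
      + 2 ^ (2 * CARD('n) + 1) * T / q
        * ((C0 * (24 * real CARD('n) + 144) / R\<^sup>2) powr q * R ^ (2 * CARD('n) + 2))"
proof -
  \<comment> \<open>A bound for the modulus of \<open>M_coeff M u t * hlaplace (cutoff R) x\<close>,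
    uniform in x and t.\<close>
  define D where "D = C0 * (24 * real CARD('n) + 144) / R\<^sup>2"
  define B where "B = (cutoff_box R :: 'n heis set) \<times> {0..T}"
  \<comment> \<open>The integrand of the weak formulation is copied verbatim so that the instance
    for the cut-off matches; its part with two time derivatives is zero on [0, T].\<close>
  define F where "F = (\<lambda>z. indicator (Omega T) z *\<^sub>R
    (case z of (x, t) \<Rightarrow> M_coeff M u t * u t x *
       (hlaplace (cutoff R) x + hlaplace (dt T (dt T (\<lambda>t. cutoff R)) t) x)))"
  define G where "G = (\<lambda>z. indicator (Omega T) z *\<^sub>R (case z of (x, t) \<Rightarrow> \<bar>u t x\<bar> powr p))"
  have 1: "dt T (\<lambda>t. cutoff R) t = (\<lambda>x :: 'n heis. 0)" if "t \<in> {0..T}" for t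
    by (rule dt_const_in_time[OF T that, of _ "cutoff R"]) simp
  have 2: "dt T (dt T (\<lambda>t. cutoff R)) t = (\<lambda>x :: 'n heis. 0)" if "t \<in> {0..T}" for t
    by (rule dt_const_in_time[OF T that]) (simp add: 1)
  have C0: "0 \<le> C0" using M[of 0 0 0] by linarith
  then have D: "0 \<le> D" by (simp add: D_def)
  from sol test_function_cutoff[OF T R]
  have F: "integrable lebesgue F"
    and eq: "(LINT (x, t):Omega T|lebesgue. \<bar>u t x\<bar> powr p * cutoff R x)
        + (LINT x|lebesgue. u1 x * (cutoff R x - hlaplace (cutoff R) x))
        - (LINT x|lebesgue. u0 x * (dt T (\<lambda>t. cutoff R) 0 x - hlaplace (dt T (\<lambda>t. cutoff R) 0) x))
        = (LINT (x, t):Omega T|lebesgue. u t x * dt T (dt T (\<lambda>t. cutoff R)) t x)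
        - (LINT z|lebesgue. F z)"
    unfolding weak_solution_def F_def set_integrable_def set_lebesgue_integral_def by blast+
  have "(LINT (x, t):Omega T|lebesgue. u t x * dt T (dt T (\<lambda>t. cutoff R)) t x) = 0"
    unfolding set_lebesgue_integral_def
    by (rule integral_eq_zero_AE) (auto simp: indicator_def Omega_def 2)
  moreover have "(LINT x|lebesgue. u0 x *
      (dt T (\<lambda>t. cutoff R) 0 x - hlaplace (dt T (\<lambda>t. cutoff R) 0) x)) = 0"
    using T by (simp add: 1)
  ultimately have lhs: "(LINT (x, t):Omega T|lebesgue. \<bar>u t x\<bar> powr p * cutoff R x)
        + (LINT x|lebesgue. u1 x * (cutoff R x - hlaplace (cutoff R) x)) = - (LINT z|lebesgue. F z)"
    using eq by linarith
  have G: "integrable lebesgue G"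
    using sol by (simp add: weak_solution_def Lp_Omega_def set_integrable_def G_def)
  obtain a b where Bab: "B = cbox (a, 0) (b, T)" and box: "cutoff_box R = cbox a b"
    unfolding B_def cutoff_box_def by (metis cbox_Pair_eq cbox_interval)
  then have Bm: "B \<in> lmeasurable"
    and "measure lborel B = measure lborel (cutoff_box R :: 'n heis set) * T"
    unfolding Bab box using T by (simp_all add: content_Pair)
  then have mB: "measure lebesgue B = 2 ^ (2 * CARD('n) + 1) * R ^ (2 * CARD('n) + 2) * T"
    using content_cutoff_box[OF R, where 'n = 'n] Bab by (simp add: measure_completion)
  \<comment> \<open>Young's inequality alone would leave a constant that is not integrable over the
    whole space-time. Since \<open>F\<close> vanishes outside \<open>B\<close>, the constant can be
    multiplied by the indicator of \<open>B\<close>.\<close>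
  have bound: "norm (F z) \<le> G z / p + D powr q / q * indicator B z" for z
  proof (cases "z \<in> Omega T \<and> z \<in> B")
    case False
    moreover have "F z = 0" if "z \<in> Omega T" "z \<notin> B"
      using that cutoff_outside_box(2)[OF R, of "fst z"] 2[of "snd z"]
      by (cases z) (auto simp: F_def Omega_def B_def)
    moreover have "0 \<le> G z / p" "0 \<le> D powr q / q * indicator B z"
      using p q by (auto simp: G_def split: prod.split)
    ultimately show ?thesis by (cases "z \<in> Omega T") (auto simp: F_def)
  next
    case True
    obtain x t where z: "z = (x, t)" by (cases z)
    with True have t: "t \<in> {0..T}" by (simp add: B_def)
    have "\<bar>M_coeff M u t\<bar> \<le> C0"
      unfolding M_coeff_def using t by (intro M) auto
    then have "\<bar>M_coeff M u t\<bar> * \<bar>hlaplace (cutoff R) x\<bar> \<le> D"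
      unfolding D_def using mult_mono[OF _ hlaplace_cutoff_bound[OF R] C0] by fastforce
    then have "\<bar>u t x\<bar> * (\<bar>M_coeff M u t\<bar> * \<bar>hlaplace (cutoff R) x\<bar>) \<le> \<bar>u t x\<bar> * D"
      by (intro mult_left_mono) auto
    then have "norm (F z) \<le> \<bar>u t x\<bar> * D"
      using True t by (simp add: F_def z 2 abs_mult mult_ac)
    also have "\<dots> \<le> \<bar>u t x\<bar> powr p / p + D powr q / q"
      by (rule Youngs_inequality[OF p q]) (use D in auto)
    finally show ?thesis using True by (simp add: G_def z)
  qed
  have iB: "integrable lebesgue (\<lambda>z. D powr q / q * indicator B z)"
    using Bm by (intro integrable_mult_right) (auto simp: fmeasurable_def)
  have "norm (LINT z|lebesgue. F z) \<le> (LINT z|lebesgue. G z / p + D powr q / q * indicator B z)"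
    using Bochner_Integration.integral_norm_bound_integral[OF F Bochner_Integration.integrable_add[OF _ iB] bound] G
    by simp
  also have "\<dots> = (LINT z|lebesgue. G z) / p + D powr q / q * measure lebesgue B"
    by (subst Bochner_Integration.integral_add) (use G iB Bm in auto)
  also have "D powr q / q * measure lebesgue B
      = 2 ^ (2 * CARD('n) + 1) * T / q * (D powr q * R ^ (2 * CARD('n) + 2))"
    by (simp add: mB)
  finally show ?thesis
    using lhs unfolding D_def G_def set_lebesgue_integral_def real_norm_def by linarith
qed

text \<open>With r the radius, the expression has order r to the power m - 2 q, which the hypothesis
  makes at most -1. For m = Q and q conjugate to p, equality in the hypothesis is the critical case
  p = (Q + 1) / (Q - 1).\<close>

lemma LIMSEQ_powr_times_power:
  fixes A q :: real
  assumes "real m + 1 \<le> 2 * q"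
  shows "(\<lambda>k. (A / (real (Suc k))\<^sup>2) powr q * real (Suc k) ^ m) \<longlonglongrightarrow> 0"
proof (rule Lim_null_comparison)
  have "norm ((A / r\<^sup>2) powr q * r ^ m) \<le> A powr q / r" if r: "1 \<le> r" for r
  proof -
    have "r\<^sup>2 = r powr 2" using r by simp
    then have "(A / r\<^sup>2) powr q = A powr q * r powr (- (2 * q))"
      by (simp only: powr_divide powr_powr) (simp add: powr_minus divide_inverse)
    moreover have "r ^ m = r powr real m"
      using r by (simp add: powr_realpow)
    ultimately have "norm ((A / r\<^sup>2) powr q * r ^ m) = A powr q * r powr (real m - 2 * q)"
      by (simp add: powr_add[symmetric] abs_mult)
    also have "\<dots> \<le> A powr q * r powr (- 1)"
      using assms r by (intro mult_left_mono powr_mono) auto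
    finally show ?thesis using r by (simp add: powr_minus divide_inverse)
  qed
  then show "\<forall>\<^sub>F k in sequentially. norm ((A / (real (Suc k))\<^sup>2) powr q * real (Suc k) ^ m)
      \<le> A powr q / real (Suc k)"
    by (intro always_eventually allI) simp
  show "(\<lambda>k. A powr q / real (Suc k)) \<longlonglongrightarrow> 0"
    by real_asymp
qed

theorem theorem4p7:
  fixes M :: "real \<Rightarrow> real \<Rightarrow> real \<Rightarrow> real"
    and u0 u1 :: "'n::finite heis \<Rightarrow> real"
    and Q T C0 p :: real
  assumes "Q = 2 * real CARD('n) + 2"
    and "T > 0"
    and "\<And>t a b. t \<ge> 0 \<Longrightarrow> a \<ge> 0 \<Longrightarrow> b \<ge> 0 \<Longrightarrow> 0 < M t a b \<and> M t a b \<le> C0"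
    and "integrable lebesgue u0" and "integrable lebesgue u1"
    and "(LINT x|lebesgue. u1 x) \<ge> 0"
    and "1 < p" and "p \<le> (Q + 1) / (Q - 1)"
  shows "\<not> (\<exists>u. weak_solution T M p u0 u1 u \<and> \<not> trivial_on_Omega T u)"
proof -
  have "trivial_on_Omega T u" if sol: "weak_solution T M p u0 u1 u" for u
  proof -
    define q where "q = p / (p - 1)"
    define K where "K = 24 * real CARD('n) + 144"
    \<comment> \<open>The shift keeps all radii at least 1, so they are nonzero and
      \<open>K / (R k)\<^sup>2\<close> never exceeds \<open>K\<close>.\<close>
    define R where "R = (\<lambda>k. real (Suc k))"
    have q: "1 < q" "1 / p + 1 / q = 1"
      using \<open>1 < p\<close> by (simp_all add: q_def field_simps)
    have Q: "Q > 2" using assms(1) by (simp add: zero_less_card_finite)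
    have "p * (Q - 1) \<le> Q + 1" using assms(8) Q by (simp add: field_simps)
    \<comment> \<open>The inequality p (Q - 1) <= Q + 1 rearranges to (Q + 1) (p - 1) <= 2 p;
      division by p - 1 > 0 gives the claim.\<close>
    then have qQ: "Q + 1 \<le> 2 * q"
      using \<open>1 < p\<close> by (simp add: q_def field_simps)
    have C0: "0 < C0" using assms(3)[of 0 0 0] by simp
    have R1: "1 \<le> R k" for k by (simp add: R_def)
    have M: "\<bar>M t a b\<bar> \<le> C0" if "t \<ge> 0" "a \<ge> 0" "b \<ge> 0" for t a b
      using assms(3)[OF that] by simp
    define g where "g = (\<lambda>z. indicator (Omega T) z *\<^sub>R (case z of (x, t) \<Rightarrow> \<bar>u t x\<bar> powr p))"
    have g: "integrable lebesgue g"
      using sol by (simp add: weak_solution_def Lp_Omega_def set_integrable_def g_def)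
    have g0: "0 \<le> g z" for z by (simp add: g_def split: prod.split)
    have L1: "(\<lambda>k. LINT (x, t):Omega T|lebesgue. \<bar>u t x\<bar> powr p * cutoff (R k) x) \<longlonglongrightarrow> (LINT z|lebesgue. g z)"
    proof -
      have "(\<lambda>k. LINT z|lebesgue. g z * cutoff (R k) (fst z)) \<longlonglongrightarrow> (LINT z|lebesgue. g z)"
      \<comment> \<open>The dominating function is \<open>g\<close> itself, since the cut-offs lie
        between 0 and 1.\<close>
      proof (rule integral_dominated_convergence)
        show "g \<in> borel_measurable lebesgue" using g by simp
        have "continuous_on UNIV (\<lambda>z :: 'n heis \<times> real. cutoff (R k) (fst z))" for k
          by (intro continuous_on_compose2[OF continuous_on_cutoff, of UNIV] continuous_intros) auto
        then have "(\<lambda>z :: 'n heis \<times> real. cutoff (R k) (fst z)) \<in> borel_measurable lebesgue" for k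
          by (rule borel_measurable_lebesgue_continuous)
        then show "(\<lambda>z. g z * cutoff (R k) (fst z)) \<in> borel_measurable lebesgue" for k
          using g by simp
        show "AE z in lebesgue. (\<lambda>k. g z * cutoff (R k) (fst z)) \<longlonglongrightarrow> g z"
          using tendsto_mult_left[OF LIMSEQ_cutoff, of "g _" "fst _"] unfolding R_def
          by (intro always_eventually allI) (simp del: of_nat_Suc)
        show "AE z in lebesgue. norm (g z * cutoff (R k) (fst z)) \<le> g z" for k
          by (intro always_eventually allI) (simp add: abs_mult g0 cutoff_bounds mult_left_le)
      qed fact
      then show ?thesis
        by (simp add: set_lebesgue_integral_def g_def case_prod_beta mult_ac)
    qed
    have L2: "(\<lambda>k. LINT x|lebesgue. u1 x * (cutoff (R k) x - hlaplace (cutoff (R k)) x))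
        \<longlonglongrightarrow> (LINT x|lebesgue. u1 x)"
    proof (rule integral_dominated_convergence)
      show "u1 \<in> borel_measurable lebesgue" using assms(5) by simp
      have "(\<lambda>x. cutoff (R k) x - hlaplace (cutoff (R k)) (x :: 'n heis)) \<in> borel_measurable lebesgue" for k
        by (intro borel_measurable_lebesgue_continuous continuous_on_diff continuous_on_cutoff
            continuous_on_hlaplace_cutoff)
      then show "(\<lambda>x. u1 x * (cutoff (R k) x - hlaplace (cutoff (R k)) x)) \<in> borel_measurable lebesgue" for k
        using assms(5) by simp
      \<comment> \<open>The 1 bounds the cut-off and \<open>K\<close> its Kohn-Laplacian, uniformly
        over all radii.\<close>
      show "integrable lebesgue (\<lambda>x. \<bar>u1 x\<bar> * (1 + K))" using assms(5) by simp
      have "(\<lambda>k. u1 x * (cutoff (R k) x - hlaplace (cutoff (R k)) x)) \<longlonglongrightarrow> u1 x * (1 - 0)" for x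
        unfolding R_def by (intro tendsto_intros LIMSEQ_cutoff LIMSEQ_hlaplace_cutoff)
      then show "AE x in lebesgue. (\<lambda>k. u1 x * (cutoff (R k) x - hlaplace (cutoff (R k)) x)) \<longlonglongrightarrow> u1 x"
        by simp
      have "\<bar>cutoff (R k) x - hlaplace (cutoff (R k)) x\<bar> \<le> 1 + K" for k and x :: "'n heis"
      proof -
        have "K / (R k)\<^sup>2 \<le> K"
          using R1[of k] by (simp add: K_def divide_le_eq mult_le_cancel_left1)
        moreover have "\<bar>hlaplace (cutoff (R k)) x\<bar> \<le> K / (R k)\<^sup>2"
          unfolding K_def using R1[of k] by (intro hlaplace_cutoff_bound) auto
        ultimately show ?thesis
          using cutoff_bounds[of "R k" x] by linarith
      qed
      then show "AE x in lebesgue. norm (u1 x * (cutoff (R k) x - hlaplace (cutoff (R k)) x))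
          \<le> \<bar>u1 x\<bar> * (1 + K)" for k
        by (auto simp: abs_mult intro!: mult_left_mono)
    qed
    have "real (2 * CARD('n) + 2) + 1 \<le> 2 * q" using qQ assms(1) by simp
    from tendsto_mult_right_zero[OF LIMSEQ_powr_times_power[OF this]]
    have L3: "(\<lambda>k. 2 ^ (2 * CARD('n) + 1) * T / q *
        ((C0 * K / (R k)\<^sup>2) powr q * R k ^ (2 * CARD('n) + 2))) \<longlonglongrightarrow> 0"
      unfolding R_def .
    \<comment> \<open>All limits are finite because \<open>g\<close> and \<open>u1\<close> are
      integrable, so the fraction 1 / p of the integral of \<open>g\<close> can afterwards be
      absorbed into the left-hand side.\<close>
    have "(LINT z|lebesgue. g z) + (LINT x|lebesgue. u1 x) \<le> (LINT z|lebesgue. g z) / p + 0"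
    proof (rule LIMSEQ_le[OF tendsto_add[OF L1 L2] tendsto_add[OF tendsto_const L3]])
      have "(LINT (x, t):Omega T|lebesgue. \<bar>u t x\<bar> powr p * cutoff (R k) x)
          + (LINT x|lebesgue. u1 x * (cutoff (R k) x - hlaplace (cutoff (R k)) x))
          \<le> (LINT z|lebesgue. g z) / p
          + 2 ^ (2 * CARD('n) + 1) * T / q * ((C0 * K / (R k)\<^sup>2) powr q * R k ^ (2 * CARD('n) + 2))" for k
        using weak_solution_cutoff_estimate[OF sol assms(2) _ assms(7) q M, of "R k"] R1[of k]
        unfolding g_def K_def set_lebesgue_integral_def by linarith
      then show "\<exists>N. \<forall>k\<ge>N. (LINT (x, t):Omega T|lebesgue. \<bar>u t x\<bar> powr p * cutoff (R k) x)
          + (LINT x|lebesgue. u1 x * (cutoff (R k) x - hlaplace (cutoff (R k)) x))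
          \<le> (LINT z|lebesgue. g z) / p
          + 2 ^ (2 * CARD('n) + 1) * T / q * ((C0 * K / (R k)\<^sup>2) powr q * R k ^ (2 * CARD('n) + 2))"
        by blast
    qed
    then have "(LINT z|lebesgue. g z) * (1 - 1 / p) \<le> 0"
      using assms(6) by (simp add: algebra_simps)
    then have "(LINT z|lebesgue. g z) \<le> 0"
      using assms(7) by (simp add: mult_le_0_iff)
    moreover have "0 \<le> (LINT z|lebesgue. g z)"
      using g0 by simp
    ultimately have "(LINT z|lebesgue. g z) = 0" by (rule antisym)
    then have "AE z in lebesgue. g z = 0"
      using integral_nonneg_eq_0_iff_AE[OF g] g0 by simp
    then show ?thesis
      \<comment> \<open>On \<open>Omega T\<close> the function \<open>g\<close> is a power of the
        modulus of \<open>u\<close>, and \<open>powr\<close> vanishes only at base 0.\<close>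
      unfolding trivial_on_Omega_def by eventually_elim (auto simp: g_def)
  qed
  then show ?thesis by blast
qed

end
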